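(* For each integer $k\ge 1$ and each integer $m\ge 1$, if $N\ge 2mk$ is an integer, then $$\mathrm{Perm}(N,m;k)=c(m,k),$$ where $c(m,k)$ is the number of $(2^{2k}-1)$-tuples $(r_I)_{\emptyset\ne I\subset\{1,\dots,2k\}}$ of non-negative integers such that (i) $r_I\in\{0,1\}$ whenever $\#I$ is odd; (ii) $\sum_{I:\ i\in I} r_I=m$ for each $i\in\{1,\dots,2k\}$. Moreover, for each fixed integer $k\ge1$, the function $m\mapsto c(m,k)$ is non-decreasing and satisfies $$c(m,k)\asymp_k m^{2^{2k-1}-2k-1}+1 .$$
   Context: $S_N$ is the group of permutations of $[N]=\{1,\dots,N\}$. For $\sigma\in S_N$ and $T\subset[N]$ with $\sigma(T)=T$, if the restriction $\sigma|_T$ (a permutation of $T$) is the product of $\ell$ disjoint cycles (fixed points count as cycles of length 1), set $\mu(\sigma|_T)=(-1)^\ell$. Define $$\mathrm{Perm}(N,m;k):=\frac1{N!}\sum_{\sigma\in S_N}\Bigl|\sum_{\substack{T\subset[N],\ \#T=m\\ \sigma(T)=T}}\mu(\sigma|_T)\Bigr|^{2k}.$$ The notation $X\asymp_k Y$ means that there are positive constants $C_1,C_2$ depending only on $k$ with $C_1Y\le X\le C_2Y$ (here for all integers $m\ge1$). *)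

theory Defs
  imports Complex_Main "HOL-Combinatorics.Orbits"
begin

text \<open>
  For a permutation \<open>\<tau>\<close> of a finite set \<open>T\<close>, the supports of the disjoint cycles of \<open>\<tau>\<close> are its
  orbits on \<open>T\<close>; a fixed point \<open>x\<close> contributes the orbit \<open>{x}\<close>, that is, a cycle of length 1.
\<close>

definition num_cycles :: "'a set \<Rightarrow> ('a \<Rightarrow> 'a) \<Rightarrow> nat" where
  "num_cycles T \<tau> = card (orbit \<tau> ` T)"

definition mu :: "'a set \<Rightarrow> ('a \<Rightarrow> 'a) \<Rightarrow> int" where
  "mu T \<tau> = (- 1) ^ num_cycles T \<tau>"

definition Perm_moment :: "nat \<Rightarrow> nat \<Rightarrow> nat \<Rightarrow> real" where
  "Perm_moment N m k =
     1 / fact N *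
     (\<Sum>\<sigma> | \<sigma> permutes {1..N}.
        \<bar>\<Sum>T | T \<subseteq> {1..N} \<and> card T = m \<and> \<sigma> ` T = T.
            real_of_int (mu T (perm_restrict \<sigma> T))\<bar> ^ (2 * k))"

text \<open>
  The tuples are extensional functions on the non-empty subsets of \<open>{1..2 * k}\<close>, so that equal
  tuples are equal functions. For \<open>k \<ge> 1\<close>, condition (ii) bounds every entry by \<open>m\<close>, so the set
  is finite and \<open>card\<close> is the true number of tuples.
\<close>

definition tuples :: "nat \<Rightarrow> nat \<Rightarrow> (nat set \<Rightarrow> nat) set" where
  "tuples m k =
     {r \<in> (Pow {1..2 * k} - {{}}) \<rightarrow>\<^sub>E (UNIV :: nat set).
        (\<forall>I \<in> Pow {1..2 * k} - {{}}. odd (card I) \<longrightarrow> r I \<in> {0, 1}) \<and>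
        (\<forall>i \<in> {1..2 * k}. (\<Sum>I | I \<subseteq> {1..2 * k} \<and> i \<in> I. r I) = m)}"

definition c :: "nat \<Rightarrow> nat \<Rightarrow> nat" where
  "c m k = card (tuples m k)"

end

theory Submission
  imports Defs
begin

text \<open>
  Let \<open>J = {1..2 * k}\<close>. Expanding the power of the inner sum turns the moment into a sum over pairs of a
  permutation \<open>\<sigma>\<close> and a family of \<open>\<sigma>\<close>-invariant \<open>m\<close>-subsets \<open>T i\<close> indexed by \<open>i \<in> J\<close>. Such a family is
  the same as a colouring \<open>f\<close> of \<open>{1..N}\<close> by subsets of \<open>J\<close>, where \<open>f x\<close> collects the indices \<open>i\<close> with
  \<open>x \<in> T i\<close>, and \<open>\<sigma>\<close> leaves the family invariant exactly if \<open>f \<circ> \<sigma> = f\<close> (\<open>power_sum_invariant_subsets\<close>).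

  The function \<^const>\<open>mu\<close> is the sign character up to the factor \<open>(- 1) ^ m\<close> (\<open>mu_conv_sign\<close>), which
  disappears in a product of \<open>2 * k\<close> terms. Hence, for a fixed \<open>f\<close>, the summand is a character of the
  stabilizer of \<open>f\<close>, and the sum over \<open>\<sigma>\<close> is either the order of the stabilizer or 0. The character
  is trivial precisely if no colour of odd cardinality is used twice: a transposition of two points of
  the same odd colour has value \<open>- 1\<close> (\<open>sum_weight_stabilizer\<close>). By Burnside's lemma
  (\<open>sum_card_stabilizer\<close>) the sum of the orders of the stabilizers is \<open>N!\<close> times the number of orbits of
  such colourings. An orbit is given by the multiplicities of the colours, and those of the non-empty
  colours form a tuple as counted by \<^const>\<open>c\<close>; for \<open>N \<ge> 2 * m * k\<close> every tuple arises, the empty colour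
  taking up the remaining points (\<open>card_types_eq_c\<close>).

  The number \<open>c m k\<close> grows with \<open>m\<close> since the entry at \<open>J\<close> can be increased freely (\<open>c_le_Suc\<close>). Its order
  of growth is governed by the \<open>2 ^ (2 * k - 1) - 1\<close> entries at non-empty sets of even cardinality, which
  satisfy \<open>2 * k\<close> linear equations. From above, \<open>2 * k\<close> of these entries are determined by all the
  others (\<open>c_upper_bound\<close>). From below, the pigeonhole principle gives many assignments of small numbers
  with equal sums, and differences of such assignments perturb a constant solution (\<open>c_lower_bound\<close>).
\<close>

section \<open>Cycle counts and signs\<close>

lemma orbit_eq_iff_mem:
  assumes "permutation p"
  shows "orbit p y = orbit p z \<longleftrightarrow> z \<in> orbit p y"
proof
  assume "orbit p y = orbit p z"
  then show "z \<in> orbit p y"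
    using permutation_self_in_orbit[OF assms] by simp
next
  assume "z \<in> orbit p y"
  moreover from cyclic_on_orbit'[OF assms] have "cyclic_on p (orbit p y)" .
  ultimately show "orbit p y = orbit p z"
    by (metis orbit_cyclic_eq3)
qed

lemma num_cycles_insert_fixpoint:
  assumes q: "q permutes S" and fin: "finite S" and x: "x \<notin> S"
  shows "num_cycles (insert x S) q = Suc (num_cycles S q)"
proof -
  have "q x = x"
    using q x by (simp add: permutes_def)
  then have orb: "orbit q x = {x}"
    by (simp add: orbit_eq_singleton_iff)
  have "orbit q x \<notin> orbit q ` S"
    using permutes_orbit_subset[OF q] x orb by force
  then show ?thesis
    using fin by (simp add: num_cycles_def)
qed

text \<open>
Composing with the transposition splices the new point \<open>x\<close> into the cycle through \<open>b\<close>, just before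
\<open>b\<close>. Cycles never merge or split, so on \<open>S\<close> the orbit relations of the two permutations agree.
\<close>
lemma num_cycles_insert_into_cycle:
  assumes q: "q permutes S" and fin: "finite S" and x: "x \<notin> S" and b: "b \<in> S"
  shows "num_cycles (insert x S) (transpose x b \<circ> q) = num_cycles S q"
proof -
  define p where "p = transpose x b \<circ> q"
  define \<rho> where "\<rho> = (\<lambda>y. if y = x then b else y)"
  have p_permutes: "p permutes insert x S"
    unfolding p_def using permutes_subset[OF q] b
    by (intro permutes_compose permutes_swap_id) auto
  have perm_p: "permutation p" and perm_q: "permutation q"
    using p_permutes q fin by (auto simp: permutation_permutes)
  have qx: "q x = x"
    using q x by (simp add: permutes_def)
  have qS: "q y \<in> S" if "y \<in> S" for y
    using that q by (simp add: permutes_in_image)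
  have px: "p x = b"
    by (simp add: p_def qx)
  have p_eq: "p y = (if q y = b then x else q y)" if "y \<in> S" for y
    using qS[OF that] x by (auto simp: p_def transpose_def)
  \<comment> \<open>A step of \<open>q\<close> into \<open>b\<close> becomes two steps of \<open>p\<close>, through \<open>x\<close>; every other step is kept.\<close>
  have to_p: "z \<in> orbit p y" if "z \<in> orbit q y" "y \<in> S" for y z
    using that
  proof (induction rule: orbit.induct)
    case base
    then show ?case
      using px p_eq[of y] by (metis orbit.base orbit.step)
  next
    case (step z)
    then have "z \<in> S"
      using permutes_orbit_subset[OF q] by blast
    then show ?case
      using step px p_eq[of z] by (metis orbit.step)
  qed
  \<comment> \<open>Contracting the new point to its successor turns every step of \<open>p\<close> into a step of \<open>q\<close> or
    into no step.\<close>
  have \<rho>_step: "\<rho> (p z) = \<rho> z \<or> \<rho> (p z) = q (\<rho> z)" if "z \<in> insert x S" for z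
    using that px p_eq[of z] qS[of z] x b by (cases "z = x") (auto simp: \<rho>_def)
  have to_q: "\<rho> z \<in> orbit q y" if "z \<in> orbit p y" "y \<in> S" for y z
    using that
  proof (induction rule: orbit.induct)
    case base
    then have "\<rho> y = y"
      using x by (auto simp: \<rho>_def)
    then show ?case
      using \<rho>_step[of y] base permutation_self_in_orbit[OF perm_q, of y]
      by (auto intro: orbit.base)
  next
    case (step z)
    then have "z \<in> insert x S"
      using permutes_orbit_subset[OF p_permutes] by blast
    then show ?case
      using step \<rho>_step[of z] by (auto intro: orbit.step)
  qed
  have same: "orbit p y = orbit p z \<longleftrightarrow> orbit q y = orbit q z" if "y \<in> S" "z \<in> S" for y z
  proof -
    have "\<rho> z = z"
      using that x by (auto simp: \<rho>_def)
    then show ?thesis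
      using to_p[of z y] to_q[of z y] that
      by (auto simp: orbit_eq_iff_mem perm_p perm_q)
  qed
  have "orbit p x = orbit p b"
    using permutation_orbit_step[OF perm_p, of x] px by simp
  then have "orbit p ` insert x S = orbit p ` S"
    using b by auto
  \<comment> \<open>Sending the \<open>p\<close>-orbit of \<open>y\<close> to its \<open>q\<close>-orbit is well defined and injective by
    the previous fact.\<close>
  moreover have "card (orbit p ` S) = card (orbit q ` S)"
  proof (rule bij_betw_same_card)
    show "bij_betw (\<lambda>w. orbit q (SOME y. y \<in> S \<and> orbit p y = w)) (orbit p ` S) (orbit q ` S)"
    proof (rule bij_betw_imageI)
      have sel: "(SOME y'. y' \<in> S \<and> orbit p y' = orbit p y) \<in> S \<and>
          orbit p (SOME y'. y' \<in> S \<and> orbit p y' = orbit p y) = orbit p y" if "y \<in> S" for y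
        by (rule someI[of _ y]) (use that in auto)
      then have sel_q: "orbit q (SOME y'. y' \<in> S \<and> orbit p y' = orbit p y) = orbit q y"
        if "y \<in> S" for y
        using same that by blast
      show "inj_on (\<lambda>w. orbit q (SOME y. y \<in> S \<and> orbit p y = w)) (orbit p ` S)"
        by (simp add: inj_on_def sel_q same)
      show "(\<lambda>w. orbit q (SOME y. y \<in> S \<and> orbit p y = w)) ` orbit p ` S = orbit q ` S"
        by (auto simp: sel_q image_image)
    qed
  qed
  ultimately show ?thesis
    by (simp add: num_cycles_def p_def)
qed

text \<open>
A cycle of length \<open>l\<close> has sign \<open>(- 1) ^ (l - 1)\<close>, and the lengths add up to \<open>card T\<close>. The induction
builds \<open>\<tau>\<close> one point at a time: a new fixed point changes the cycle count and the cardinality, a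
point spliced into a cycle changes the sign and the cardinality. The gain over \<^const>\<open>mu\<close> is that
\<^const>\<open>sign\<close> is multiplicative.
\<close>
lemma mu_conv_sign:
  assumes "finite T" "\<tau> permutes T"
  shows "mu T \<tau> = (- 1) ^ card T * sign \<tau>"
  using assms
proof (induction T arbitrary: \<tau> rule: finite_induct)
  case empty
  then show ?case
    by (simp add: mu_def num_cycles_def sign_id)
next
  case (insert x T)
  from insert.prems obtain b q where \<tau>: "\<tau> = transpose x b \<circ> q" "b \<in> insert x T" "q permutes T"
  proof -
    have "\<tau> \<in> {p. p permutes insert x T}"
      using insert.prems by simp
    then show thesis
      unfolding permutes_insert using that by auto
  qed
  then have IH: "mu T q = (- 1) ^ card T * sign q"
    by (simp add: insert.IH)
  have perm_q: "permutation q"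
    using \<tau> insert.hyps by (auto simp: permutation_permutes)
  show ?case
  proof (cases "b = x")
    case True
    then show ?thesis
      using IH \<tau> insert.hyps by (simp add: mu_def num_cycles_insert_fixpoint)
  next
    case False
    then have "sign \<tau> = - sign q"
      using \<tau> perm_q by (simp add: sign_compose sign_swap_id permutation_swap_id)
    moreover have "num_cycles (insert x T) \<tau> = num_cycles T q"
      using False \<tau> insert.hyps by (simp add: num_cycles_insert_into_cycle)
    ultimately show ?thesis
      using IH insert.hyps by (simp add: mu_def)
  qed
qed

lemma perm_restrict_permutes:
  assumes "\<sigma> permutes V" "\<sigma> ` T = T" "finite T"
  shows "perm_restrict \<sigma> T permutes T"
proof (rule bij_imp_permutes)
  have "inj_on \<sigma> T"
    using permutes_inj_on[OF assms(1)] .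
  then have "bij_betw \<sigma> T T"
    using assms(2) by (simp add: bij_betw_def)
  then show "bij_betw (perm_restrict \<sigma> T) T T"
    by (simp add: bij_betw_cong[of T "perm_restrict \<sigma> T" \<sigma>] perm_restrict_simps)
qed (simp add: perm_restrict_simps)

text \<open>
On a disjoint union of invariant sets a permutation is the composition of its restrictions.
\<close>
lemma sign_perm_restrict_UN:
  assumes "finite L" "\<sigma> permutes V" "\<And>I. I \<in> L \<Longrightarrow> finite (A I) \<and> \<sigma> ` A I = A I"
    and "disjoint_family_on A L"
  shows "sign (perm_restrict \<sigma> (\<Union>I\<in>L. A I)) = (\<Prod>I\<in>L. sign (perm_restrict \<sigma> (A I)))"
  using assms(1,3,4)
proof (induction L rule: finite_induct)
  case empty
  have "perm_restrict \<sigma> {} = id"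
    by (auto simp: perm_restrict_def)
  then show ?case
    by (simp add: sign_id)
next
  case (insert I L)
  let ?U = "\<Union>I\<in>L. A I"
  have fin: "finite (A I)" "finite ?U"
    using insert by auto
  have "\<sigma> ` ?U = (\<Union>I\<in>L. \<sigma> ` A I)"
    by blast
  also have "\<dots> = ?U"
    using insert.prems by simp
  finally have inv: "\<sigma> ` ?U = ?U" .
  have pI: "perm_restrict \<sigma> (A I) permutes A I" and pU: "perm_restrict \<sigma> ?U permutes ?U"
    using perm_restrict_permutes[OF assms(2)] fin inv insert.prems by auto
  have disj: "A I \<inter> ?U = {}"
    using insert.prems(2) insert.hyps by (auto simp: disjoint_family_on_def)
  have "perm_restrict \<sigma> (\<Union>I\<in>insert I L. A I) = perm_restrict \<sigma> (A I) \<circ> perm_restrict \<sigma> ?U"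
    using perm_restrict_union[OF pI pU disj] by simp
  moreover have "permutation (perm_restrict \<sigma> (A I))" "permutation (perm_restrict \<sigma> ?U)"
    using pI pU fin by (auto simp: permutation_permutes)
  moreover have "disjoint_family_on A L"
    using insert.prems(2) by (auto simp: disjoint_family_on_def)
  ultimately show ?case
    using insert by (simp add: sign_compose del: o_apply)
qed

section \<open>Burnside's lemma for colourings\<close>

definition colour_stabilizer :: "'a set \<Rightarrow> ('a \<Rightarrow> 'b) \<Rightarrow> ('a \<Rightarrow> 'a) set" where
  "colour_stabilizer V f = {\<sigma>. \<sigma> permutes V \<and> (\<forall>x\<in>V. f (\<sigma> x) = f x)}"

text \<open>
A colour type is a complete invariant of the orbits of the permutations of \<open>V\<close> acting on colourings
of \<open>V\<close>: two colourings are related by a permutation exactly if their multisets of colours agree.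
\<close>
definition colour_type :: "'a set \<Rightarrow> ('a \<Rightarrow> 'b) \<Rightarrow> 'b multiset" where
  "colour_type V f = image_mset f (mset_set V)"

lemma colour_type_comp:
  assumes "\<sigma> permutes V"
  shows "colour_type V (f \<circ> \<sigma>) = colour_type V f"
proof -
  have "colour_type V (f \<circ> \<sigma>) = image_mset f (image_mset \<sigma> (mset_set V))"
    by (simp add: colour_type_def multiset.map_comp)
  also have "image_mset \<sigma> (mset_set V) = mset_set V"
    using assms by (simp add: image_mset_mset_set permutes_inj_on permutes_image)
  finally show ?thesis
    by (simp only: colour_type_def)
qed

lemma colour_type_cong:
  "(\<And>x. x \<in> V \<Longrightarrow> f x = g x) \<Longrightarrow> colour_type V f = colour_type V g"
  unfolding colour_type_def by (intro image_mset_cong) (metis elem_mset_set finite_set_mset mset_set.infinite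
    empty_iff set_mset_empty)

lemma count_colour_type:
  assumes "finite V"
  shows "count (colour_type V f) I = card {x \<in> V. f x = I}"
proof -
  have "f -` {I} \<inter> V = {x \<in> V. f x = I}"
    by auto
  then show ?thesis
    using assms by (simp add: colour_type_def count_image_mset)
qed

lemma ex_colouring_of_type:
  assumes "finite V" "size M = card V"
  shows "\<exists>f. colour_type V f = M"
  using assms
proof (induction V arbitrary: M rule: finite_induct)
  case empty
  then show ?case
    by (simp add: colour_type_def)
next
  case (insert x V)
  then obtain I M' where M: "M = add_mset I M'"
    by (metis card_insert_disjoint size_eq_Suc_imp_eq_union)
  then obtain f where f: "colour_type V f = M'"
    using insert by auto
  have "colour_type V (f(x := I)) = M'"
    using f insert.hyps by (metis colour_type_cong fun_upd_other)
  then have "colour_type (insert x V) (f(x := I)) = M"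
    using insert.hyps M by (simp add: colour_type_def)
  then show ?case
    by blast
qed

text \<open>
The permutations that carry \<open>f\<close> to \<open>g\<close> form a coset of the stabilizer of \<open>g\<close>; \<open>\<tau>\<close> is a
representative.
\<close>
lemma card_fibre_eq_card_stabilizer:
  assumes V: "finite V" and g: "g \<in> extensional V" and \<tau>: "\<tau> permutes V"
    and g_eq: "\<And>x. x \<in> V \<Longrightarrow> g x = f (\<tau> x)"
  shows "card {\<sigma>. \<sigma> permutes V \<and> restrict (f \<circ> \<sigma>) V = g} = card (colour_stabilizer V g)"
proof (rule bij_betw_same_card[symmetric])
  show "bij_betw (\<lambda>\<rho>. \<tau> \<circ> \<rho>) (colour_stabilizer V g)
      {\<sigma>. \<sigma> permutes V \<and> restrict (f \<circ> \<sigma>) V = g}"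
  proof (rule bij_betw_byWitness[where f' = "\<lambda>\<sigma>. inv \<tau> \<circ> \<sigma>"])
    show "\<forall>\<rho>\<in>colour_stabilizer V g. inv \<tau> \<circ> (\<tau> \<circ> \<rho>) = \<rho>"
      using permutes_inv_o(2)[OF \<tau>] by (simp add: o_assoc)
    show "\<forall>\<sigma>\<in>{\<sigma>. \<sigma> permutes V \<and> restrict (f \<circ> \<sigma>) V = g}. \<tau> \<circ> (inv \<tau> \<circ> \<sigma>) = \<sigma>"
      using permutes_inv_o(1)[OF \<tau>] by (simp add: o_assoc)
    show "(\<lambda>\<rho>. \<tau> \<circ> \<rho>) ` colour_stabilizer V g
        \<subseteq> {\<sigma>. \<sigma> permutes V \<and> restrict (f \<circ> \<sigma>) V = g}"
    proof (intro image_subsetI CollectI conjI)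
      fix \<rho> assume "\<rho> \<in> colour_stabilizer V g"
      then have \<rho>: "\<rho> permutes V" "\<And>x. x \<in> V \<Longrightarrow> g (\<rho> x) = g x"
        by (auto simp: colour_stabilizer_def)
      show "\<tau> \<circ> \<rho> permutes V"
        using \<rho>(1) \<tau> by (rule permutes_compose)
      show "restrict (f \<circ> (\<tau> \<circ> \<rho>)) V = g"
      proof (rule extensionalityI[of _ V])
        fix x assume "x \<in> V"
        then show "restrict (f \<circ> (\<tau> \<circ> \<rho>)) V x = g x"
          using \<rho> g_eq[of "\<rho> x"] by (simp add: permutes_in_image)
      qed (use g in auto)
    qed
    show "(\<lambda>\<sigma>. inv \<tau> \<circ> \<sigma>) ` {\<sigma>. \<sigma> permutes V \<and> restrict (f \<circ> \<sigma>) V = g}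
        \<subseteq> colour_stabilizer V g"
    proof (intro image_subsetI)
      fix \<sigma> assume "\<sigma> \<in> {\<sigma>. \<sigma> permutes V \<and> restrict (f \<circ> \<sigma>) V = g}"
      then have \<sigma>: "\<sigma> permutes V" "restrict (f \<circ> \<sigma>) V = g"
        by auto
      have "g (inv \<tau> (\<sigma> x)) = g x" if "x \<in> V" for x
      proof -
        have "inv \<tau> (\<sigma> x) \<in> V"
          using \<sigma>(1) permutes_inv[OF \<tau>] that by (simp add: permutes_in_image)
        then have "g (inv \<tau> (\<sigma> x)) = f (\<sigma> x)"
          using g_eq permutes_inverses(1)[OF \<tau>] by simp
        also have "\<dots> = g x"
          using \<sigma>(2) that by auto
        finally show ?thesis .
      qed
      then show "inv \<tau> \<circ> \<sigma> \<in> colour_stabilizer V g"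
        using permutes_compose[OF \<sigma>(1) permutes_inv[OF \<tau>]]
        by (simp add: colour_stabilizer_def)
    qed
  qed
qed

text \<open>
The colourings of the given type form one orbit. Every permutation carries \<open>f\<close> to exactly one
colouring \<open>g\<close> in it, and the fibre over \<open>g\<close> is as large as the stabilizer of \<open>g\<close>; hence the sum counts
all permutations.
\<close>
lemma sum_card_stabilizer_of_type:
  assumes V: "finite V" and K: "finite K" and f: "f \<in> V \<rightarrow>\<^sub>E K"
  shows "(\<Sum>g | g \<in> V \<rightarrow>\<^sub>E K \<and> colour_type V g = colour_type V f. card (colour_stabilizer V g))
    = fact (card V)"
proof -
  let ?G = "{g \<in> V \<rightarrow>\<^sub>E K. colour_type V g = colour_type V f}"
  let ?act = "\<lambda>\<sigma>. restrict (f \<circ> \<sigma>) V"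
  have finG: "finite ?G"
    using finite_PiE[OF V, of "\<lambda>_. K"] K by simp
  have fib: "card (colour_stabilizer V g) = card {\<sigma>. \<sigma> permutes V \<and> ?act \<sigma> = g}"
    if "g \<in> ?G" for g
  proof -
    have "image_mset g (mset_set V) = image_mset f (mset_set V)"
      using that by (simp add: colour_type_def)
    from image_mset_eq_implies_permutes[OF V this]
    obtain \<tau> where "\<tau> permutes V" "\<forall>x\<in>V. g x = f (\<tau> x)" .
    then show ?thesis
      using that V by (subst card_fibre_eq_card_stabilizer[of V g \<tau> f]) (auto simp: PiE_def)
  qed
  have maps: "?act ` {\<sigma>. \<sigma> permutes V} \<subseteq> ?G"
  proof (intro image_subsetI CollectI conjI)
    fix \<sigma> assume "\<sigma> \<in> {\<sigma>. \<sigma> permutes V}"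
    then have \<sigma>: "\<sigma> permutes V"
      by simp
    then show "?act \<sigma> \<in> V \<rightarrow>\<^sub>E K"
      using f by (auto simp: permutes_in_image)
    have "colour_type V (?act \<sigma>) = colour_type V (f \<circ> \<sigma>)"
      by (rule colour_type_cong) simp
    then show "colour_type V (?act \<sigma>) = colour_type V f"
      using colour_type_comp[OF \<sigma>] by simp
  qed
  have "(\<Sum>g\<in>?G. card (colour_stabilizer V g)) =
      (\<Sum>g\<in>?G. \<Sum>\<sigma> | \<sigma> \<in> {\<sigma>. \<sigma> permutes V} \<and> ?act \<sigma> = g. 1)"
    using fib by (intro sum.cong) auto
  also have "\<dots> = (\<Sum>\<sigma> | \<sigma> permutes V. 1)"
    using finite_permutations[OF V] finG maps by (rule sum.group)
  also have "\<dots> = fact (card V)"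
    using card_permutations[OF refl V] by simp
  finally show ?thesis .
qed

text \<open>
Burnside's lemma for colourings: pairs of a colouring and a permutation fixing it are counted by
the number of orbits times the order of the group. The orbits are represented by colour types, and
\<open>P\<close> selects any union of orbits.
\<close>
lemma sum_card_stabilizer:
  assumes V: "finite V" and K: "finite K"
  shows "(\<Sum>g | g \<in> V \<rightarrow>\<^sub>E K \<and> P (colour_type V g). card (colour_stabilizer V g))
    = fact (card V) * card {colour_type V g | g. g \<in> V \<rightarrow>\<^sub>E K \<and> P (colour_type V g)}"
proof -
  let ?X = "{g \<in> V \<rightarrow>\<^sub>E K. P (colour_type V g)}"
  have fin: "finite ?X"
    using finite_PiE[OF V, of "\<lambda>_. K"] K by simp
  have "(\<Sum>g\<in>?X. card (colour_stabilizer V g)) =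
      (\<Sum>t\<in>colour_type V ` ?X. \<Sum>g | g \<in> ?X \<and> colour_type V g = t. card (colour_stabilizer V g))"
    using fin by (rule sum.image_gen)
  also have "\<dots> = (\<Sum>t\<in>colour_type V ` ?X. fact (card V))"
  proof (rule sum.cong)
    fix t assume "t \<in> colour_type V ` ?X"
    then obtain f where f: "f \<in> V \<rightarrow>\<^sub>E K" "P (colour_type V f)" "t = colour_type V f"
      by auto
    then have "{g. g \<in> ?X \<and> colour_type V g = t} =
        {g. g \<in> V \<rightarrow>\<^sub>E K \<and> colour_type V g = colour_type V f}"
      by auto
    then show "(\<Sum>g | g \<in> ?X \<and> colour_type V g = t. card (colour_stabilizer V g)) = fact (card V)"
      using sum_card_stabilizer_of_type[OF V K f(1)] by simp
  qed simp
  also have "\<dots> = fact (card V) * card (colour_type V ` ?X)"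
    by simp
  also have "colour_type V ` ?X = {colour_type V g | g. g \<in> V \<rightarrow>\<^sub>E K \<and> P (colour_type V g)}"
    by auto
  finally show ?thesis .
qed

section \<open>Characters of colour stabilizers\<close>

text \<open>
A family of subsets of \<open>V\<close> indexed by \<open>J\<close> is encoded as the colouring that sends a point to the set
of indices of the members containing it; the layers recover the family.
\<close>
definition layer :: "'a set \<Rightarrow> ('a \<Rightarrow> 'b set) \<Rightarrow> 'b \<Rightarrow> 'a set" where
  "layer V f i = {x \<in> V. i \<in> f x}"

definition weight :: "'a set \<Rightarrow> 'b set \<Rightarrow> ('a \<Rightarrow> 'b set) \<Rightarrow> ('a \<Rightarrow> 'a) \<Rightarrow> int" where
  "weight V J f \<sigma> = (\<Prod>i\<in>J. mu (layer V f i) (perm_restrict \<sigma> (layer V f i)))"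

lemma finite_layer [simp]: "finite V \<Longrightarrow> finite (layer V f i)"
  by (simp add: layer_def)

lemma permutes_image_eq_if_subset:
  assumes "\<sigma> permutes V" "finite T" "\<sigma> ` T \<subseteq> T"
  shows "\<sigma> ` T = T"
  using assms by (meson endo_inj_surj permutes_inj_on)

text \<open>
The colour of a point records which layers contain it. Since \<open>\<sigma>\<close> is injective, an invariant layer
neither gains nor loses points under \<open>\<sigma>\<close>, so invariance of the layers means that colours are kept.
\<close>
lemma stabilizes_layers_iff:
  assumes V: "finite V" and f: "f \<in> V \<rightarrow> Pow J" and \<sigma>: "\<sigma> permutes V"
  shows "(\<forall>i\<in>J. \<sigma> ` layer V f i = layer V f i) \<longleftrightarrow> \<sigma> \<in> colour_stabilizer V f"
proof
  assume inv: "\<forall>i\<in>J. \<sigma> ` layer V f i = layer V f i"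
  have "i \<in> f (\<sigma> x) \<longleftrightarrow> i \<in> f x" if "x \<in> V" "i \<in> J" for x i
  proof -
    have "\<sigma> x \<in> layer V f i \<longleftrightarrow> x \<in> layer V f i"
      using inv that(2) permutes_inj[OF \<sigma>] by (metis inj_image_mem_iff)
    then show ?thesis
      using that \<sigma> by (simp add: layer_def permutes_in_image)
  qed
  moreover have "f x \<subseteq> J" "f (\<sigma> x) \<subseteq> J" if "x \<in> V" for x
    using f that \<sigma> by (auto simp: permutes_in_image Pi_iff)
  ultimately have "f (\<sigma> x) = f x" if "x \<in> V" for x
    using that by blast
  then show "\<sigma> \<in> colour_stabilizer V f"
    using \<sigma> by (simp add: colour_stabilizer_def)
next
  assume "\<sigma> \<in> colour_stabilizer V f"
  then have "\<sigma> ` layer V f i \<subseteq> layer V f i" for i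
    by (auto simp: colour_stabilizer_def layer_def permutes_in_image)
  then show "\<forall>i\<in>J. \<sigma> ` layer V f i = layer V f i"
    using permutes_image_eq_if_subset[OF \<sigma>] V by simp
qed

text \<open>
Expanding the power as a product over \<open>J\<close> gives a sum over families of invariant subsets, which is
then rewritten in terms of colourings.
\<close>
lemma power_sum_invariant_subsets:
  assumes V: "finite V" and J: "finite J" and \<sigma>: "\<sigma> permutes V"
  shows "(\<Sum>T | T \<subseteq> V \<and> card T = m \<and> \<sigma> ` T = T. mu T (perm_restrict \<sigma> T)) ^ card J =
    (\<Sum>f | f \<in> {f \<in> V \<rightarrow>\<^sub>E Pow J. \<forall>i\<in>J. card (layer V f i) = m} \<and> \<sigma> \<in> colour_stabilizer V f.
      weight V J f \<sigma>)"
proof -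
  let ?A = "{T. T \<subseteq> V \<and> card T = m \<and> \<sigma> ` T = T}"
  let ?F = "{f. f \<in> {f \<in> V \<rightarrow>\<^sub>E Pow J. \<forall>i\<in>J. card (layer V f i) = m} \<and> \<sigma> \<in> colour_stabilizer V f}"
  let ?g = "\<lambda>T. mu T (perm_restrict \<sigma> T)"
  let ?col = "\<lambda>h. \<lambda>x\<in>V. {i \<in> J. x \<in> h i}"
  let ?lay = "\<lambda>f. \<lambda>i\<in>J. layer V f i"
  have fin: "finite ?A"
    using V by simp
  have lay_col: "layer V (?col h) i = h i" if "h \<in> J \<rightarrow>\<^sub>E ?A" "i \<in> J" for h i
    using that by (auto simp: layer_def PiE_iff)
  have "(\<Sum>T\<in>?A. ?g T) ^ card J = (\<Prod>i\<in>J. \<Sum>T\<in>?A. ?g T)"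
    by simp
  also have "\<dots> = (\<Sum>h\<in>J \<rightarrow>\<^sub>E ?A. \<Prod>i\<in>J. ?g (h i))"
    using J fin by (rule prod_sum_PiE)
  also have "\<dots> = (\<Sum>f\<in>?F. weight V J f \<sigma>)"
  proof (rule sum.reindex_bij_witness[where i = ?lay and j = ?col])
    fix h assume h: "h \<in> J \<rightarrow>\<^sub>E ?A"
    show "?lay (?col h) = h"
      using h lay_col[OF h] by (intro extensionalityI[of _ J]) (auto simp: PiE_iff)
    have "?col h \<in> V \<rightarrow> Pow J"
      by auto
    moreover have "\<forall>i\<in>J. \<sigma> ` layer V (?col h) i = layer V (?col h) i"
      using h lay_col[OF h] by (auto simp: PiE_iff)
    ultimately have "\<sigma> \<in> colour_stabilizer V (?col h)"
      using stabilizes_layers_iff[OF V _ \<sigma>] by blast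
    moreover have "\<forall>i\<in>J. card (layer V (?col h) i) = m"
      using h lay_col[OF h] by (auto simp: PiE_iff)
    ultimately show "?col h \<in> ?F"
      by auto
    show "weight V J (?col h) \<sigma> = (\<Prod>i\<in>J. ?g (h i))"
      using lay_col[OF h] by (simp add: weight_def)
  next
    fix f assume f: "f \<in> ?F"
    then have inv: "\<forall>i\<in>J. \<sigma> ` layer V f i = layer V f i"
      using stabilizes_layers_iff[OF V _ \<sigma>, of f J] by (auto simp: PiE_def)
    show "?lay f \<in> J \<rightarrow>\<^sub>E ?A"
      using f inv by (auto simp: layer_def)
    show "?col (?lay f) = f"
    proof (rule extensionalityI[of _ V])
      fix x assume "x \<in> V"
      moreover from this have "f x \<subseteq> J"
        using f by (auto simp: PiE_iff)
      ultimately show "?col (?lay f) x = f x"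
        by (auto simp: layer_def)
    qed (use f in \<open>auto simp: PiE_iff\<close>)
  qed
  finally show ?thesis .
qed

text \<open>
Replacing \<^const>\<open>mu\<close> by \<^const>\<open>sign\<close> costs a factor \<open>(- 1) ^ m\<close> for each index, and there are evenly
many of them.
\<close>
lemma weight_conv_sign:
  assumes V: "finite V" and J: "even (card J)"
    and m: "\<forall>i\<in>J. card (layer V f i) = m"
    and \<sigma>: "\<sigma> permutes V" "\<forall>i\<in>J. \<sigma> ` layer V f i = layer V f i"
  shows "weight V J f \<sigma> = (\<Prod>i\<in>J. sign (perm_restrict \<sigma> (layer V f i)))"
proof -
  have "weight V J f \<sigma> = (\<Prod>i\<in>J. (- 1) ^ m * sign (perm_restrict \<sigma> (layer V f i)))"
    unfolding weight_def
  proof (rule prod.cong)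
    fix i assume "i \<in> J"
    then show "mu (layer V f i) (perm_restrict \<sigma> (layer V f i)) =
        (- 1) ^ m * sign (perm_restrict \<sigma> (layer V f i))"
      using mu_conv_sign[OF _ perm_restrict_permutes[OF \<sigma>(1)], of "layer V f i"] m \<sigma>(2) V
      by simp
  qed simp
  also have "\<dots> = ((- 1) ^ m) ^ card J * (\<Prod>i\<in>J. sign (perm_restrict \<sigma> (layer V f i)))"
    by (simp add: prod.distrib)
  also have "((- 1 :: int) ^ m) ^ card J = 1"
    using J by (simp add: flip: power_mult)
  finally show ?thesis
    by simp
qed

text \<open>
A transposition of two points of colour \<open>f x\<close> acts within the layers with index in \<open>f x\<close> and
trivially on the others, so it changes the sign in \<open>card (f x)\<close> factors.
\<close>
lemma weight_comp_transpose:
  assumes V: "finite V" and J: "finite J" "even (card J)" and f: "f \<in> V \<rightarrow> Pow J"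
    and m: "\<forall>i\<in>J. card (layer V f i) = m"
    and \<sigma>: "\<sigma> \<in> colour_stabilizer V f"
    and xy: "x \<in> V" "y \<in> V" "x \<noteq> y" "f x = f y"
  shows "\<sigma> \<circ> transpose x y \<in> colour_stabilizer V f"
    and "weight V J f (\<sigma> \<circ> transpose x y) = (- 1) ^ card (f x) * weight V J f \<sigma>"
proof -
  let ?t = "transpose x y"
  have \<sigma>p: "\<sigma> permutes V" and inv: "\<forall>i\<in>J. \<sigma> ` layer V f i = layer V f i"
    using stabilizes_layers_iff[OF V f, of \<sigma>] \<sigma> by (auto simp: colour_stabilizer_def)
  have tp: "\<sigma> \<circ> ?t permutes V"
    using xy by (intro permutes_compose[OF _ \<sigma>p] permutes_swap_id)
  have "f (\<sigma> (?t z)) = f z" if "z \<in> V" for z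
    using \<sigma> xy that by (auto simp: colour_stabilizer_def transpose_def)
  then show st: "\<sigma> \<circ> ?t \<in> colour_stabilizer V f"
    using tp by (simp add: colour_stabilizer_def)
  then have inv': "\<forall>i\<in>J. (\<sigma> \<circ> ?t) ` layer V f i = layer V f i"
    using stabilizes_layers_iff[OF V f tp] by blast
  have factor: "sign (perm_restrict (\<sigma> \<circ> ?t) (layer V f i)) =
      (if i \<in> f x then - 1 else 1) * sign (perm_restrict \<sigma> (layer V f i))" if "i \<in> J" for i
  proof (cases "i \<in> f x")
    case True
    then have "x \<in> layer V f i" "y \<in> layer V f i"
      using xy by (auto simp: layer_def)
    then have "perm_restrict (\<sigma> \<circ> ?t) (layer V f i) = perm_restrict \<sigma> (layer V f i) \<circ> ?t"
      by (auto simp: perm_restrict_def transpose_def)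
    moreover have "perm_restrict \<sigma> (layer V f i) permutes layer V f i"
      using perm_restrict_permutes[OF \<sigma>p, of "layer V f i"] inv that V by simp
    then have "permutation (perm_restrict \<sigma> (layer V f i))"
      by (rule permutes_imp_permutation[OF finite_layer[OF V]])
    ultimately have "sign (perm_restrict (\<sigma> \<circ> ?t) (layer V f i)) =
        sign (perm_restrict \<sigma> (layer V f i)) * sign ?t"
      by (metis sign_compose permutation_swap_id)
    then show ?thesis
      using True xy(3) by (simp add: sign_swap_id)
  next
    case False
    then have "perm_restrict (\<sigma> \<circ> ?t) (layer V f i) = perm_restrict \<sigma> (layer V f i)"
      using xy by (auto simp: perm_restrict_def transpose_def layer_def fun_eq_iff)
    then show ?thesis
      using False by simp
  qed
  have "f x \<subseteq> J"
    using f xy by auto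
  then have "(\<Prod>i\<in>J. if i \<in> f x then - 1 else 1 :: int) = (- 1) ^ card (f x)"
    using J by (simp add: prod.If_cases Int_absorb1)
  then show "weight V J f (\<sigma> \<circ> ?t) = (- 1) ^ card (f x) * weight V J f \<sigma>"
    unfolding weight_conv_sign[OF V J(2) m \<sigma>p inv] weight_conv_sign[OF V J(2) m tp inv']
    by (simp only: prod.distrib factor cong: prod.cong)
qed

text \<open>
Each layer is a union of colour classes, so the sign of \<open>\<sigma>\<close> on the class of a colour \<open>I\<close> enters once
for each \<open>i \<in> I\<close>. For \<open>card I\<close> even this power is 1; for \<open>card I\<close> odd the class has at most one point,
on which every permutation is trivial.
\<close>
lemma weight_eq_1:
  assumes V: "finite V" and J: "finite J" "even (card J)" and f: "f \<in> V \<rightarrow> Pow J"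
    and m: "\<forall>i\<in>J. card (layer V f i) = m"
    and \<sigma>: "\<sigma> \<in> colour_stabilizer V f"
    and single: "\<And>I. odd (card I) \<Longrightarrow> card {x \<in> V. f x = I} \<le> 1"
  shows "weight V J f \<sigma> = 1"
proof -
  have \<sigma>p: "\<sigma> permutes V" and inv: "\<forall>i\<in>J. \<sigma> ` layer V f i = layer V f i"
    using stabilizes_layers_iff[OF V f, of \<sigma>] \<sigma> by (auto simp: colour_stabilizer_def)
  define A where "A = (\<lambda>I. {x \<in> V. f x = I})"
  define s where "s = (\<lambda>I. sign (perm_restrict \<sigma> (A I)))"
  have finA: "finite (A I)" for I
    using V by (simp add: A_def)
  have "\<sigma> ` A I \<subseteq> A I" for I
    using \<sigma> by (auto simp: A_def colour_stabilizer_def permutes_in_image)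
  then have invA: "\<sigma> ` A I = A I" for I
    using permutes_image_eq_if_subset[OF \<sigma>p finA] by blast
  have layers: "sign (perm_restrict \<sigma> (layer V f i)) = (\<Prod>I | I \<in> Pow J \<and> i \<in> I. s I)" for i
  proof -
    have "layer V f i = (\<Union>I\<in>{I. I \<in> Pow J \<and> i \<in> I}. A I)"
      using f by (auto simp: layer_def A_def)
    moreover have "disjoint_family_on A {I. I \<in> Pow J \<and> i \<in> I}"
      by (auto simp: disjoint_family_on_def A_def)
    ultimately show ?thesis
      using sign_perm_restrict_UN[OF _ \<sigma>p, of "{I. I \<in> Pow J \<and> i \<in> I}" A] J finA invA
      by (simp add: s_def)
  qed
  have sI: "s I ^ card I = 1" for I
  proof (cases "odd (card I)")
    case True
    have "perm_restrict \<sigma> (A I) permutes A I"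
      using perm_restrict_permutes[OF \<sigma>p invA finA] .
    moreover have "card (A I) \<le> 1"
      using single[OF True] by (simp add: A_def)
    then have "A I = {} \<or> (\<exists>x. A I = {x})"
      using finA[of I] by (metis card_0_eq card_1_singletonE le_neq_implies_less less_one)
    ultimately have "perm_restrict \<sigma> (A I) = id"
      by (auto simp: permutes_sing)
    then show ?thesis
      by (simp add: s_def sign_id)
  next
    case False
    then show ?thesis
      by (auto simp: s_def sign_def)
  qed
  have "weight V J f \<sigma> = (\<Prod>i\<in>J. \<Prod>I | I \<in> Pow J \<and> i \<in> I. s I)"
    unfolding weight_conv_sign[OF V J(2) m \<sigma>p inv] layers ..
  also have "\<dots> = (\<Prod>I\<in>Pow J. \<Prod>i | i \<in> J \<and> i \<in> I. s I)"
    using J by (intro prod.swap_restrict) auto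
  also have "\<dots> = (\<Prod>I\<in>Pow J. s I ^ card I)"
  proof (rule prod.cong)
    fix I assume "I \<in> Pow J"
    then have "{i. i \<in> J \<and> i \<in> I} = I"
      by auto
    then show "(\<Prod>i | i \<in> J \<and> i \<in> I. s I) = s I ^ card I"
      by simp
  qed simp
  also have "\<dots> = 1"
    using sI by simp
  finally show ?thesis .
qed

text \<open>
On the stabilizer the weight is a character with values 1 and \<open>- 1\<close>, so its sum is the group order if the
character is trivial and 0 otherwise. It is non-trivial as soon as two points share a colour of odd
cardinality, because their transposition then has weight \<open>- 1\<close>.
\<close>
lemma sum_weight_stabilizer:
  assumes V: "finite V" and J: "finite J" "even (card J)" and f: "f \<in> V \<rightarrow> Pow J"
    and m: "\<forall>i\<in>J. card (layer V f i) = m"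
  shows "(\<Sum>\<sigma>\<in>colour_stabilizer V f. weight V J f \<sigma>) =
    (if \<forall>I. odd (card I) \<longrightarrow> card {x \<in> V. f x = I} \<le> 1
     then int (card (colour_stabilizer V f)) else 0)"
proof (cases "\<forall>I. odd (card I) \<longrightarrow> card {x \<in> V. f x = I} \<le> 1")
  case True
  then have "(\<Sum>\<sigma>\<in>colour_stabilizer V f. weight V J f \<sigma>) = (\<Sum>\<sigma>\<in>colour_stabilizer V f. 1)"
    using weight_eq_1[OF V J f m] by (intro sum.cong) auto
  then show ?thesis
    using True by simp
next
  case False
  then obtain I where I: "odd (card I)" "\<not> card {x \<in> V. f x = I} \<le> 1"
    by blast
  then obtain x y where xy: "x \<in> V" "y \<in> V" "x \<noteq> y" "f x = I" "f y = I"
    using V by (auto simp: card_le_Suc0_iff_eq)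
  let ?t = "transpose x y"
  have "(\<Sum>\<sigma>\<in>colour_stabilizer V f. weight V J f \<sigma>) =
      (\<Sum>\<sigma>\<in>colour_stabilizer V f. weight V J f (\<sigma> \<circ> ?t))"
    by (rule sum.reindex_bij_witness[where i = "\<lambda>\<sigma>. \<sigma> \<circ> ?t" and j = "\<lambda>\<sigma>. \<sigma> \<circ> ?t"])
      (use xy weight_comp_transpose(1)[OF V J f m] in \<open>auto simp: comp_assoc\<close>)
  also have "\<dots> = (\<Sum>\<sigma>\<in>colour_stabilizer V f. - weight V J f \<sigma>)"
    using weight_comp_transpose(2)[OF V J f m] xy I by (intro sum.cong) auto
  finally have "(\<Sum>\<sigma>\<in>colour_stabilizer V f. weight V J f \<sigma>) = 0"
    by (simp add: sum_negf)
  then show ?thesis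
    unfolding if_not_P[OF False] .
qed

section \<open>The moment as a number of tuples\<close>

text \<open>
The types of the colourings that contribute to the moment: the first condition makes the character of
the stabilizer trivial, the second says that every layer has \<open>m\<close> points.
\<close>
definition admissible :: "'b set \<Rightarrow> nat \<Rightarrow> 'b set multiset \<Rightarrow> bool" where
  "admissible J m M \<longleftrightarrow> (\<forall>I. odd (card I) \<longrightarrow> count M I \<le> 1) \<and>
    (\<forall>i\<in>J. (\<Sum>I | I \<subseteq> J \<and> i \<in> I. count M I) = m)"

lemma card_layer_conv_type:
  assumes V: "finite V" and J: "finite J" and f: "f \<in> V \<rightarrow> Pow J"
  shows "card (layer V f i) = (\<Sum>I | I \<subseteq> J \<and> i \<in> I. count (colour_type V f) I)"
proof -
  have "layer V f i = (\<Union>I\<in>{I. I \<subseteq> J \<and> i \<in> I}. {x \<in> V. f x = I})"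
    using f by (auto simp: layer_def)
  also have "card \<dots> = (\<Sum>I | I \<subseteq> J \<and> i \<in> I. card {x \<in> V. f x = I})"
    using V J by (intro card_UN_disjoint) auto
  finally show ?thesis
    by (simp add: count_colour_type[OF V])
qed

text \<open>
After exchanging the two sums, each colouring contributes the order of its stabilizer or nothing, and
Burnside's lemma turns the total into a number of orbits.
\<close>
lemma moment_eq_card_types:
  assumes V: "finite V" and J: "finite J" "even (card J)"
  shows "(\<Sum>\<sigma> | \<sigma> permutes V.
        (\<Sum>T | T \<subseteq> V \<and> card T = m \<and> \<sigma> ` T = T. mu T (perm_restrict \<sigma> T)) ^ card J) =
      int (fact (card V) * card {M. size M = card V \<and> set_mset M \<subseteq> Pow J \<and> admissible J m M})"
proof -
  let ?F = "{f \<in> V \<rightarrow>\<^sub>E Pow J. \<forall>i\<in>J. card (layer V f i) = m}"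
  have finF: "finite ?F"
    using finite_PiE[OF V, of "\<lambda>_. Pow J"] J by simp
  have good_iff: "f \<in> ?F \<and> (\<forall>I. odd (card I) \<longrightarrow> card {x \<in> V. f x = I} \<le> 1) \<longleftrightarrow>
      f \<in> V \<rightarrow>\<^sub>E Pow J \<and> admissible J m (colour_type V f)" for f
    using card_layer_conv_type[OF V J(1), of f]
    by (auto simp: admissible_def count_colour_type[OF V] PiE_def)
  have types: "{colour_type V f | f. f \<in> V \<rightarrow>\<^sub>E Pow J \<and> admissible J m (colour_type V f)} =
      {M. size M = card V \<and> set_mset M \<subseteq> Pow J \<and> admissible J m M}"
  proof (intro set_eqI iffI)
    fix M assume "M \<in> {M. size M = card V \<and> set_mset M \<subseteq> Pow J \<and> admissible J m M}"
    then have M: "size M = card V" "set_mset M \<subseteq> Pow J" "admissible J m M"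
      by auto
    obtain f where f: "colour_type V f = M"
      using ex_colouring_of_type[OF V M(1)] by blast
    have "colour_type V (restrict f V) = M"
      using f colour_type_cong[of V "restrict f V" f] by simp
    moreover have "f ` V \<subseteq> Pow J"
      using M(2) V by (simp add: colour_type_def flip: f)
    then have "restrict f V \<in> V \<rightarrow>\<^sub>E Pow J"
      by (simp add: PiE_iff image_subset_iff)
    ultimately show "M \<in> {colour_type V f | f. f \<in> V \<rightarrow>\<^sub>E Pow J \<and> admissible J m (colour_type V f)}"
      using M(3) by blast
  qed (use V in \<open>fastforce simp: colour_type_def PiE_iff\<close>)
  have "(\<Sum>\<sigma> | \<sigma> permutes V.
        (\<Sum>T | T \<subseteq> V \<and> card T = m \<and> \<sigma> ` T = T. mu T (perm_restrict \<sigma> T)) ^ card J) =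
      (\<Sum>\<sigma> | \<sigma> permutes V. \<Sum>f | f \<in> ?F \<and> \<sigma> \<in> colour_stabilizer V f. weight V J f \<sigma>)"
    by (intro sum.cong refl power_sum_invariant_subsets[OF V J(1)]) simp
  also have "\<dots> = (\<Sum>f\<in>?F. \<Sum>\<sigma> | \<sigma> \<in> {\<sigma>. \<sigma> permutes V} \<and> \<sigma> \<in> colour_stabilizer V f. weight V J f \<sigma>)"
    using finite_permutations[OF V] finF by (rule sum.swap_restrict)
  also have "\<dots> = (\<Sum>f\<in>?F. \<Sum>\<sigma>\<in>colour_stabilizer V f. weight V J f \<sigma>)"
    by (intro sum.cong) (auto simp: colour_stabilizer_def)
  also have "\<dots> = (\<Sum>f\<in>?F. if \<forall>I. odd (card I) \<longrightarrow> card {x \<in> V. f x = I} \<le> 1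
      then int (card (colour_stabilizer V f)) else 0)"
    by (intro sum.cong sum_weight_stabilizer[OF V J]) auto
  also have "\<dots> = (\<Sum>f | f \<in> ?F \<and> (\<forall>I. odd (card I) \<longrightarrow> card {x \<in> V. f x = I} \<le> 1).
      int (card (colour_stabilizer V f)))"
    using finF by (rule sum.inter_filter[symmetric])
  also have "\<dots> = int (\<Sum>f | f \<in> V \<rightarrow>\<^sub>E Pow J \<and> admissible J m (colour_type V f).
      card (colour_stabilizer V f))"
    unfolding good_iff by simp
  also have "\<dots> = int (fact (card V) * card {M. size M = card V \<and> set_mset M \<subseteq> Pow J \<and> admissible J m M})"
    unfolding sum_card_stabilizer[OF V finite_Pow_iff[THEN iffD2, OF J(1)]] types ..
  finally show ?thesis .
qed

text \<open>
Summing the \<open>2 * k\<close> linear conditions counts \<open>r I\<close> with multiplicity \<open>card I \<ge> 1\<close>.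
\<close>
lemma tuples_sum_le:
  assumes "r \<in> tuples m k"
  shows "(\<Sum>I\<in>Pow {1..2 * k} - {{}}. r I) \<le> 2 * m * k"
proof -
  let ?J = "{1..2 * k}"
  have "(\<Sum>I\<in>Pow ?J - {{}}. r I) \<le> (\<Sum>I\<in>Pow ?J - {{}}. \<Sum>i | i \<in> ?J \<and> i \<in> I. r I)"
  proof (rule sum_mono)
    fix I assume I: "I \<in> Pow ?J - {{}}"
    then have eq: "{i. i \<in> ?J \<and> i \<in> I} = I"
      by auto
    have "card I > 0"
      using I finite_subset[of I ?J] by (auto simp: card_gt_0_iff)
    then show "r I \<le> (\<Sum>i | i \<in> ?J \<and> i \<in> I. r I)"
      unfolding eq by simp
  qed
  also have "\<dots> = (\<Sum>i\<in>?J. \<Sum>I | I \<in> Pow ?J - {{}} \<and> i \<in> I. r I)"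
    by (rule sum.swap_restrict) auto
  also have "\<dots> = (\<Sum>i\<in>?J. m)"
  proof (rule sum.cong)
    fix i assume "i \<in> ?J"
    moreover have "{I. I \<in> Pow ?J - {{}} \<and> i \<in> I} = {I. I \<subseteq> ?J \<and> i \<in> I}"
      by auto
    ultimately show "(\<Sum>I | I \<in> Pow ?J - {{}} \<and> i \<in> I. r I) = m"
      using assms by (simp add: tuples_def)
  qed simp
  finally show ?thesis
    by (simp add: mult_ac)
qed

text \<open>
A colour type is the same as its multiplicities. Those of the non-empty colours form a tuple, and the
multiplicity of the empty colour is what remains of the total \<open>N\<close>; the lower bound on \<open>N\<close> ensures that
this remainder is never negative.
\<close>
lemma card_types_eq_c:
  assumes N: "N \<ge> 2 * m * k"
  shows "card {M. size M = N \<and> set_mset M \<subseteq> Pow {1..2 * k} \<and> admissible {1..2 * k} m M} = c m k"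
proof -
  let ?J = "{1..2 * k}"
  let ?P = "Pow ?J - {{}}"
  let ?A = "{M. size M = N \<and> set_mset M \<subseteq> Pow ?J \<and> admissible ?J m M}"
  have finP: "finite ?P"
    by simp
  have size_eq: "size M = count M {} + (\<Sum>I\<in>?P. count M I)" if "set_mset M \<subseteq> Pow ?J" for M
  proof -
    have "size M = (\<Sum>I\<in>Pow ?J. count M I)"
      unfolding size_multiset_overloaded_eq
      using that by (intro sum.mono_neutral_left) (auto simp: not_in_iff)
    also have "\<dots> = count M {} + (\<Sum>I\<in>?P. count M I)"
      by (rule sum.remove) auto
    finally show ?thesis .
  qed
  have "bij_betw (\<lambda>M. restrict (count M) ?P) ?A (tuples m k)"
  proof (rule bij_betw_imageI)
    show "inj_on (\<lambda>M. restrict (count M) ?P) ?A"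
    proof (rule inj_onI)
      fix M M' assume M: "M \<in> ?A" "M' \<in> ?A" and restr: "restrict (count M) ?P = restrict (count M') ?P"
      have eq: "count M I = count M' I" if "I \<in> ?P" for I
        using fun_cong[OF restr, of I] that by simp
      have "(\<Sum>I\<in>?P. count M I) = (\<Sum>I\<in>?P. count M' I)"
        using eq by (rule sum.cong[OF refl])
      moreover have "size M = size M'" "set_mset M \<subseteq> Pow ?J" "set_mset M' \<subseteq> Pow ?J"
        using M by auto
      ultimately have "count M {} = count M' {}"
        using size_eq[of M] size_eq[of M'] by linarith
      moreover have "count M I = 0 \<and> count M' I = 0" if "I \<notin> Pow ?J" for I
        using M that by (auto simp: count_eq_zero_iff)
      ultimately show "M = M'"
        using eq by (intro multiset_eqI) (metis Diff_iff singletonD)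
    qed
    show "(\<lambda>M. restrict (count M) ?P) ` ?A = tuples m k"
    proof (intro set_eqI iffI)
      fix r assume "r \<in> (\<lambda>M. restrict (count M) ?P) ` ?A"
      then obtain M where M: "admissible ?J m M" and r: "r = restrict (count M) ?P"
        by auto
      have "(\<Sum>I | I \<subseteq> ?J \<and> i \<in> I. r I) = (\<Sum>I | I \<subseteq> ?J \<and> i \<in> I. count M I)" for i
        by (intro sum.cong) (auto simp: r)
      then show "r \<in> tuples m k"
        using M unfolding tuples_def admissible_def by (auto simp: r le_Suc_eq)
    next
      fix r assume r: "r \<in> tuples m k"
      let ?s = "\<Sum>I\<in>?P. r I"
      define M where "M = (\<Sum>I\<in>?P. replicate_mset (r I) I) + replicate_mset (N - ?s) {}"
      have cnt: "count M I = (if I \<in> ?P then r I else 0)" if "I \<noteq> {}" for I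
        using that finP by (simp add: M_def count_sum if_distrib cong: if_cong)
      have set: "set_mset M \<subseteq> Pow ?J"
      proof
        fix I assume "I \<in># M"
        then have "count M I \<noteq> 0"
          by simp
        then show "I \<in> Pow ?J"
          using cnt[of I] by (cases "I = {}") (auto split: if_splits)
      qed
      have "count M {} = N - ?s"
        by (simp add: M_def count_sum)
      moreover have "(\<Sum>I\<in>?P. count M I) = ?s"
        using cnt by (intro sum.cong) auto
      moreover have "?s \<le> N"
        using tuples_sum_le[OF r] N by simp
      ultimately have "size M = N"
        using size_eq[OF set] by simp
      moreover have "(\<Sum>I | I \<subseteq> ?J \<and> i \<in> I. count M I) = (\<Sum>I | I \<subseteq> ?J \<and> i \<in> I. r I)" for i
      proof (rule sum.cong)
        fix I assume "I \<in> {I. I \<subseteq> ?J \<and> i \<in> I}"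
        then show "count M I = r I"
          using cnt[of I] by auto
      qed simp
      moreover have "count M I \<le> 1" if "odd (card I)" for I
      proof -
        have "I \<noteq> {}"
          using that by auto
        then show ?thesis
          using cnt[of I] r that by (auto simp: tuples_def le_Suc_eq)
      qed
      ultimately have "M \<in> ?A"
        using set r by (auto simp: admissible_def tuples_def)
      moreover have "r = restrict (count M) ?P"
        using r cnt by (intro extensionalityI[of _ ?P]) (auto simp: tuples_def PiE_iff)
      ultimately show "r \<in> (\<lambda>M. restrict (count M) ?P) ` ?A"
        by blast
    qed
  qed
  then show ?thesis
    by (simp add: bij_betw_same_card c_def)
qed

lemma Perm_moment_eq_c:
  assumes "N \<ge> 2 * m * k"
  shows "Perm_moment N m k = real (c m k)"
proof -
  let ?S = "\<lambda>\<sigma>. \<Sum>T | T \<subseteq> {1..N} \<and> card T = m \<and> \<sigma> ` T = T. mu T (perm_restrict \<sigma> T)"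
  have "Perm_moment N m k = 1 / fact N * (\<Sum>\<sigma> | \<sigma> permutes {1..N}. real_of_int (?S \<sigma>) ^ (2 * k))"
    by (simp add: Perm_moment_def power_even_abs)
  also have "\<dots> = 1 / fact N * real_of_int (\<Sum>\<sigma> | \<sigma> permutes {1..N}. ?S \<sigma> ^ (2 * k))"
    by simp
  also have "(\<Sum>\<sigma> | \<sigma> permutes {1..N}. ?S \<sigma> ^ (2 * k)) = int (fact N * c m k)"
    using moment_eq_card_types[of "{1..N}" "{1..2 * k}" m] card_types_eq_c[OF assms] by simp
  finally show ?thesis
    by simp
qed

section \<open>Monotonicity and bounds for the number of tuples\<close>

lemma tuplesI:
  assumes "r \<in> extensional (Pow {1..2 * k} - {{}})"
    and "\<And>I. I \<in> Pow {1..2 * k} - {{}} \<Longrightarrow> odd (card I) \<Longrightarrow> r I \<le> 1"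
    and "\<And>i. i \<in> {1..2 * k} \<Longrightarrow> (\<Sum>I | I \<subseteq> {1..2 * k} \<and> i \<in> I. r I) = m"
  shows "r \<in> tuples m k"
  unfolding tuples_def
proof (intro CollectI conjI ballI impI)
  show "r \<in> (Pow {1..2 * k} - {{}}) \<rightarrow>\<^sub>E UNIV"
    using assms(1) by (simp add: PiE_iff)
next
  fix I assume "I \<in> Pow {1..2 * k} - {{}}" "odd (card I)"
  then have "r I \<le> 1"
    by (rule assms(2))
  then show "r I \<in> {0, 1}"
    by auto
qed (rule assms(3))

lemma tuplesD:
  assumes "r \<in> tuples m k"
  shows tuples_extensional: "r \<in> extensional (Pow {1..2 * k} - {{}})"
    and tuples_odd_le_1: "I \<in> Pow {1..2 * k} - {{}} \<Longrightarrow> odd (card I) \<Longrightarrow> r I \<le> 1"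
    and tuples_sum: "i \<in> {1..2 * k} \<Longrightarrow> (\<Sum>I | I \<subseteq> {1..2 * k} \<and> i \<in> I. r I) = m"
proof -
  have "r \<in> (Pow {1..2 * k} - {{}}) \<rightarrow>\<^sub>E UNIV"
    and odd: "\<forall>I\<in>Pow {1..2 * k} - {{}}. odd (card I) \<longrightarrow> r I \<in> {0, 1}"
    and sum: "\<forall>i\<in>{1..2 * k}. (\<Sum>I | I \<subseteq> {1..2 * k} \<and> i \<in> I. r I) = m"
    using assms unfolding tuples_def by blast+
  then show "r \<in> extensional (Pow {1..2 * k} - {{}})"
    by (simp add: PiE_iff)
  show "r I \<le> 1" if I: "I \<in> Pow {1..2 * k} - {{}}" "odd (card I)"
  proof -
    from odd I have "r I \<in> {0, 1}"
      by blast
    then show ?thesis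
      by auto
  qed
  show "i \<in> {1..2 * k} \<Longrightarrow> (\<Sum>I | I \<subseteq> {1..2 * k} \<and> i \<in> I. r I) = m"
    using sum by blast
qed

lemma tuples_entry_le:
  assumes "r \<in> tuples m k" "I \<in> Pow {1..2 * k} - {{}}"
  shows "r I \<le> m"
proof -
  obtain i where i: "i \<in> I"
    using assms(2) by auto
  then have iJ: "i \<in> {1..2 * k}"
    using assms(2) by blast
  have "r I \<le> (\<Sum>I | I \<subseteq> {1..2 * k} \<and> i \<in> I. r I)"
    using assms(2) i by (intro member_le_sum) auto
  also have "\<dots> = m"
    using assms(1) iJ by (rule tuples_sum)
  finally show ?thesis .
qed

lemma finite_tuples: "finite (tuples m k)"
proof (rule finite_subset)
  show "tuples m k \<subseteq> (Pow {1..2 * k} - {{}}) \<rightarrow>\<^sub>E {..m}"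
  proof
    fix r assume r: "r \<in> tuples m k"
    show "r \<in> (Pow {1..2 * k} - {{}}) \<rightarrow>\<^sub>E {..m}"
      unfolding PiE_iff using tuples_extensional[OF r] tuples_entry_le[OF r] by blast
  qed
qed (auto intro: finite_PiE)

text \<open>
The full index set \<open>{1..2 * k}\<close> has even cardinality and contains every index, so increasing its entry
by 1 raises all the sums by 1 and violates no condition.
\<close>
lemma c_le_Suc:
  assumes "k \<ge> 1"
  shows "c m k \<le> c (Suc m) k"
proof -
  let ?J = "{1..2 * k}"
  let ?f = "\<lambda>r. r(?J := Suc (r ?J))"
  have "inj_on ?f (tuples m k)"
  proof (rule inj_onI)
    fix r r' assume "?f r = ?f r'"
    then have "?f r I = ?f r' I" for I
      by (rule fun_cong)
    then have "r I = r' I" for I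
      by (cases "I = ?J") (metis fun_upd_same nat.inject, metis fun_upd_other)
    then show "r = r'" ..
  qed
  moreover have "?f ` tuples m k \<subseteq> tuples (Suc m) k"
  proof (rule image_subsetI)
    fix r assume r: "r \<in> tuples m k"
    have "(\<Sum>I | I \<subseteq> ?J \<and> i \<in> I. ?f r I) = Suc m" if "i \<in> ?J" for i
    proof -
      have "(\<Sum>I | I \<subseteq> ?J \<and> i \<in> I. ?f r I) =
          (\<Sum>I | I \<subseteq> ?J \<and> i \<in> I. r I + (if I = ?J then 1 else 0))"
        by (intro sum.cong) auto
      also have "\<dots> = (\<Sum>I | I \<subseteq> ?J \<and> i \<in> I. r I) + 1"
        using that by (simp add: sum.distrib sum.delta)
      finally show ?thesis
        using tuples_sum[OF r that] by simp
    qed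
    moreover have "?f r \<in> extensional (Pow ?J - {{}})"
      using tuples_extensional[OF r] assms by (simp add: extensional_def)
    moreover have "?f r I \<le> 1" if "I \<in> Pow ?J - {{}}" "odd (card I)" for I
    proof -
      have "I \<noteq> ?J"
        using that by auto
      then show ?thesis
        using tuples_odd_le_1[OF r that] by simp
    qed
    ultimately show "?f r \<in> tuples (Suc m) k"
      by (intro tuplesI)
  qed
  ultimately show ?thesis
    unfolding c_def using finite_tuples card_inj_on_le by blast
qed

lemma c_mono:
  assumes "k \<ge> 1" "m \<le> m'"
  shows "c m k \<le> c m' k"
  using lift_Suc_mono_le[of "\<lambda>m. c m k"] c_le_Suc[OF assms(1)] assms(2) by blast

lemma c_ge_1:
  assumes "k \<ge> 1"
  shows "c m k \<ge> 1"
proof -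
  let ?J = "{1..2 * k}"
  let ?r = "\<lambda>I\<in>Pow ?J - {{}}. if I = ?J then m else 0"
  have "(\<Sum>I | I \<subseteq> ?J \<and> i \<in> I. ?r I) = m" if "i \<in> ?J" for i
  proof -
    have "(\<Sum>I | I \<subseteq> ?J \<and> i \<in> I. ?r I) = (\<Sum>I | I \<subseteq> ?J \<and> i \<in> I. if I = ?J then m else 0)"
      by (intro sum.cong) auto
    also have "\<dots> = m"
      using that by (simp add: sum.delta)
    finally show ?thesis .
  qed
  moreover have "?r I \<le> 1" if "I \<in> Pow ?J - {{}}" "odd (card I)" for I
    using that by auto
  ultimately have "?r \<in> tuples m k"
    by (intro tuplesI) simp_all
  then show ?thesis
    unfolding c_def using finite_tuples by (metis One_nat_def Suc_leI card_gt_0_iff empty_iff)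
qed

lemma card_even_subsets:
  assumes "finite S" "S \<noteq> {}"
  shows "card {I. I \<subseteq> S \<and> even (card I)} = 2 ^ (card S - 1)"
proof -
  have "{I. I \<subseteq> S \<and> even (card I)} \<union> {I. I \<subseteq> S \<and> odd (card I)} = Pow S"
    by auto
  then have "card {I. I \<subseteq> S \<and> even (card I)} + card {I. I \<subseteq> S \<and> odd (card I)} = 2 ^ card S"
    using assms by (subst card_Un_disjoint[symmetric]) (simp_all add: card_Pow disjoint_iff)
  moreover have "card {I. I \<subseteq> S \<and> even (card I)} = card {I. I \<subseteq> S \<and> odd (card I)}"
    using card_subsupersets_even_odd[of S "{}"] assms by auto
  moreover have "(2::nat) ^ card S = 2 * 2 ^ (card S - 1)"
    using assms by (metis card_eq_0_iff power_eq_if)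
  ultimately show ?thesis
    by simp
qed

lemma card_even_subsets_containing:
  assumes "finite S" "i \<in> S" "S \<noteq> {i}"
  shows "card {I. I \<subseteq> S \<and> i \<in> I \<and> even (card I)} = 2 ^ (card S - 2)"
proof -
  let ?E = "{I. I \<subseteq> S \<and> i \<in> I \<and> even (card I)}"
  let ?O = "{I. I \<subseteq> S \<and> i \<in> I \<and> odd (card I)}"
  have "?E \<union> ?O = insert i ` Pow (S - {i})"
  proof (intro set_eqI iffI)
    fix I assume "I \<in> ?E \<union> ?O"
    then have "I = insert i (I - {i})" "I - {i} \<in> Pow (S - {i})"
      by auto
    then show "I \<in> insert i ` Pow (S - {i})"
      by blast
  qed (use assms in auto)
  moreover have "inj_on (insert i) (Pow (S - {i}))"
    by (auto simp: inj_on_def)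
  ultimately have "card (?E \<union> ?O) = 2 ^ (card S - 1)"
    using assms by (simp add: card_image card_Pow)
  moreover have "card (?E \<union> ?O) = card ?E + card ?O"
    using assms by (intro card_Un_disjoint) auto
  moreover have "card ?E = card ?O"
    using card_subsupersets_even_odd[of S "{i}"] assms by auto
  moreover have "card S - 1 = Suc (card S - 2)"
  proof -
    have "card {i} < card S"
      using assms by (intro psubset_card_mono) auto
    then show ?thesis
      by simp
  qed
  ultimately show ?thesis
    by simp
qed

lemma c_le_if_determined:
  assumes F: "F \<subseteq> Pow {1..2 * k} - {{}}"
    and det: "\<And>r r'. r \<in> tuples m k \<Longrightarrow> r' \<in> tuples m k \<Longrightarrow> (\<And>I. I \<in> F \<Longrightarrow> r I = r' I) \<Longrightarrow> r = r'"
  shows "c m k \<le> 2 ^ card {I \<in> F. odd (card I)} * (m + 1) ^ card {I \<in> F. even (card I)}"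
proof -
  have finF: "finite F"
    using F finite_subset by blast
  let ?B = "\<lambda>I. if odd (card I) then {0, 1} else {..m}"
  have "inj_on (\<lambda>r. restrict r F) (tuples m k)"
  proof (rule inj_onI)
    fix r r' assume r: "r \<in> tuples m k" "r' \<in> tuples m k" "restrict r F = restrict r' F"
    have "r I = r' I" if "I \<in> F" for I
      using fun_cong[OF r(3), of I] that by simp
    then show "r = r'"
      using det r by blast
  qed
  moreover have "(\<lambda>r. restrict r F) ` tuples m k \<subseteq> Pi\<^sub>E F ?B"
  proof (rule image_subsetI)
    fix r assume r: "r \<in> tuples m k"
    have "r I \<in> ?B I" if "I \<in> F" for I
    proof (cases "odd (card I)")
      case True
      moreover have "r I \<le> 1"
        using tuples_odd_le_1[OF r] that F True by blast
      ultimately show ?thesis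
        by auto
    next
      case False
      then show ?thesis
        using that F tuples_entry_le[OF r] by auto
    qed
    then show "restrict r F \<in> Pi\<^sub>E F ?B"
      by auto
  qed
  moreover have "finite (Pi\<^sub>E F ?B)"
    using finF by (intro finite_PiE) auto
  ultimately have "c m k \<le> card (Pi\<^sub>E F ?B)"
    unfolding c_def by (rule card_inj_on_le)
  also have "\<dots> = (\<Prod>I\<in>F. if odd (card I) then 2 else m + 1)"
    using finF by (subst card_PiE) (auto intro: prod.cong)
  also have "\<dots> = 2 ^ card {I \<in> F. odd (card I)} * (m + 1) ^ card {I \<in> F. even (card I)}"
    using finF by (simp add: prod.If_cases Int_def)
  finally show ?thesis .
qed

lemma tuples_eqI:
  assumes "r \<in> tuples m k" "r' \<in> tuples m k" "\<And>I. I \<in> Pow {1..2 * k} - {{}} \<Longrightarrow> r I = r' I"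
  shows "r = r'"
  using tuples_extensional[OF assms(1)] tuples_extensional[OF assms(2)] assms(3)
  by (rule extensionalityI)

text \<open>
If the incidence vectors of the sets in \<open>B\<close> are linearly independent, these homogeneous equations force
the two tuples to be equal: the entries outside \<open>B\<close> then determine a tuple.
\<close>
lemma tuples_diff_sum:
  assumes r: "r \<in> tuples m k" "r' \<in> tuples m k" and i: "i \<in> {1..2 * k}"
    and B: "B \<subseteq> Pow {1..2 * k}"
    and agree: "\<And>I. I \<in> Pow {1..2 * k} - {{}} \<Longrightarrow> I \<notin> B \<Longrightarrow> r I = r' I"
  shows "(\<Sum>I | I \<in> B \<and> i \<in> I. int (r I) - int (r' I)) = 0"
proof -
  have "(\<Sum>I | I \<in> B \<and> i \<in> I. int (r I) - int (r' I)) =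
      (\<Sum>I | I \<subseteq> {1..2 * k} \<and> i \<in> I. int (r I) - int (r' I))"
    using B agree by (intro sum.mono_neutral_left) auto
  also have "\<dots> = int (\<Sum>I | I \<subseteq> {1..2 * k} \<and> i \<in> I. r I) - int (\<Sum>I | I \<subseteq> {1..2 * k} \<and> i \<in> I. r' I)"
    by (simp add: sum_subtractf)
  also have "\<dots> = 0"
    using tuples_sum[OF r(1) i] tuples_sum[OF r(2) i] by simp
  finally show ?thesis .
qed

text \<open>
For \<open>k = 1\<close> the entries at \<open>{1}\<close> and \<open>{2}\<close> determine the one at \<open>{1, 2}\<close>.
\<close>
lemma c_1_le: "c m 1 \<le> 4"
proof -
  let ?F = "{{1}, {2}} :: nat set set"
  have "r = r'" if r: "r \<in> tuples m 1" "r' \<in> tuples m 1" and F: "\<And>I. I \<in> ?F \<Longrightarrow> r I = r' I" for r r'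
  proof -
    have P: "Pow {1..2 * 1} - {{}} = {{1}, {2}, {1, 2 :: nat}}"
      by (auto simp: numeral_2_eq_2 atLeastAtMostSuc_conv Pow_insert)
    have agree: "r I = r' I" if "I \<in> Pow {1..2 * 1} - {{}}" "I \<notin> {{1, 2}}" for I
    proof (rule F)
      show "I \<in> ?F"
        using that unfolding P by blast
    qed
    have "{{1, 2}} \<subseteq> Pow {1..2 * 1 :: nat}"
      by simp
    then have "(\<Sum>I | I \<in> {{1, 2}} \<and> 1 \<in> I. int (r I) - int (r' I)) = 0"
      using agree by (intro tuples_diff_sum[OF r]) simp_all
    moreover have "{I. I \<in> {{1, 2}} \<and> 1 \<in> I} = {{1, 2 :: nat}}"
      by auto
    ultimately have "r {1, 2} = r' {1, 2}"
      by simp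
    then have "r I = r' I" if "I \<in> Pow {1..2 * 1} - {{}}" for I
      using agree[OF that] by (cases "I = {1, 2}") auto
    then show ?thesis
      by (rule tuples_eqI[OF r])
  qed
  then have "c m 1 \<le> 2 ^ card {I \<in> ?F. odd (card I)} * (m + 1) ^ card {I \<in> ?F. even (card I)}"
    by (intro c_le_if_determined) auto
  moreover have odd: "{I \<in> ?F. odd (card I)} = ?F" and even: "{I \<in> ?F. even (card I)} = {}"
    by auto
  ultimately show ?thesis
    unfolding odd even by simp
qed

text \<open>
Each of the \<open>2 * k\<close> linear conditions removes one degree of freedom from the even entries: the
incidence vectors of the edges of the graph \<open>B\<close>, a star centred at 1 together with the edge \<open>{2, 3}\<close>,
are linearly independent because the graph is connected and its only cycle, the triangle on 1, 2, 3,
is odd. So the entries outside \<open>B\<close> determine the tuple; the even ones among them take at most \<open>m + 1\<close> values and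
the odd ones at most 2. For \<open>k = 1\<close> there is no room for the triangle.
\<close>
lemma c_upper_bound:
  assumes k: "k \<ge> 2"
  shows "c m k \<le> 2 ^ 2 ^ (2 * k) * (m + 1) ^ (2 ^ (2 * k - 1) - 1 - 2 * k)"
proof -
  let ?J = "{1..2 * k}"
  let ?P = "Pow ?J - {{}}"
  define B :: "nat set set" where "B = insert {2, 3} ((\<lambda>j. {1, j}) ` {2..2 * k})"
  have B_sub: "B \<subseteq> ?P"
    using k by (auto simp: B_def)
  have card_B: "card B = 2 * k"
  proof -
    have "inj_on (\<lambda>j. {1, j}) {2..2 * k}"
      by (auto simp: inj_on_def doubleton_eq_iff)
    moreover have "{2, 3} \<notin> (\<lambda>j. {1, j}) ` {2..2 * k}"
      by (auto simp: doubleton_eq_iff)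
    ultimately show ?thesis
      using k by (simp add: B_def card_image)
  qed
  have even_B: "even (card I)" if "I \<in> B" for I
    using that by (auto simp: B_def)
  have "r = r'" if r: "r \<in> tuples m k" "r' \<in> tuples m k" and F: "\<And>I. I \<in> ?P - B \<Longrightarrow> r I = r' I"
    for r r'
  proof -
    define d where "d = (\<lambda>I. int (r I) - int (r' I))"
    have sum0: "(\<Sum>I | I \<in> B \<and> i \<in> I. d I) = 0" if "i \<in> ?J" for i
      unfolding d_def using B_sub F that by (intro tuples_diff_sum[OF r]) auto
    \<comment> \<open>Here \<open>j\<close> is a leaf of the graph.\<close>
    have far: "d {1, j} = 0" if "j \<in> {4..2 * k}" for j
    proof -
      have "{I. I \<in> B \<and> j \<in> I} = {{1, j}}"
        using that by (auto simp: B_def)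
      then show ?thesis
        using sum0[of j] that by simp
    qed
    have "{I. I \<in> B \<and> 2 \<in> I} = {{1, 2}, {2, 3}}" "{I. I \<in> B \<and> 3 \<in> I} = {{1, 3}, {2, 3}}"
      using k by (auto simp: B_def)
    then have d2: "d {1, 2} + d {2, 3} = 0" and d3: "d {1, 3} + d {2, 3} = 0"
      using sum0[of 2] sum0[of 3] k by (auto simp: doubleton_eq_iff)
    have d1: "d {1, 2} + d {1, 3} = 0"
    proof -
      have "{I. I \<in> B \<and> 1 \<in> I} = (\<lambda>j. {1, j}) ` {2..2 * k}"
        by (auto simp: B_def)
      moreover have "inj_on (\<lambda>j. {1, j}) {2..2 * k}"
        by (auto simp: inj_on_def doubleton_eq_iff)
      ultimately have "(\<Sum>j\<in>{2..2 * k}. d {1, j}) = 0"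
        using sum0[of 1] k by (simp add: sum.reindex)
      moreover have "(\<Sum>j\<in>{2..2 * k}. d {1, j}) = (\<Sum>j\<in>{2, 3}. d {1, j})"
        using k far by (intro sum.mono_neutral_right) auto
      ultimately show ?thesis
        by simp
    qed
    have "d {1, 2} = 0" "d {1, 3} = 0" "d {2, 3} = 0"
      using d1 d2 d3 by linarith+
    moreover have "j = 2 \<or> j = 3 \<or> j \<in> {4..2 * k}" if "j \<in> {2..2 * k}" for j
      using that by auto
    ultimately have "d I = 0" if "I \<in> B" for I
      using that far unfolding B_def by blast
    then have "r I = r' I" if "I \<in> B" for I
      using that by (simp add: d_def)
    then show ?thesis
      using F by (intro tuples_eqI[OF r]) blast
  qed
  then have le: "c m k \<le> 2 ^ card {I \<in> ?P - B. odd (card I)} * (m + 1) ^ card {I \<in> ?P - B. even (card I)}"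
    by (intro c_le_if_determined) auto
  have "card {I \<in> ?P - B. odd (card I)} \<le> card (Pow ?J)"
    by (intro card_mono) auto
  then have odd: "card {I \<in> ?P - B. odd (card I)} \<le> 2 ^ (2 * k)"
    by (simp add: card_Pow)
  have "{I \<in> ?P - B. even (card I)} = {I. I \<subseteq> ?J \<and> even (card I)} - insert {} B"
    by auto
  also have "card \<dots> = 2 ^ (2 * k - 1) - card (insert {} B)"
  proof -
    have "insert {} B \<subseteq> {I. I \<subseteq> ?J \<and> even (card I)}"
      using B_sub even_B by auto
    then show ?thesis
      using k finite_subset[OF B_sub] card_even_subsets[of ?J]
      by (subst card_Diff_subset) auto
  qed
  also have "card (insert {} B) = 1 + 2 * k"
    using B_sub card_B finite_subset[OF B_sub] by (subst card_insert_disjoint) auto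
  finally have even: "card {I \<in> ?P - B. even (card I)} = 2 ^ (2 * k - 1) - 1 - 2 * k"
    by simp
  show ?thesis
    using le odd unfolding even
    by (meson le_trans mult_le_mono1 one_le_numeral power_increasing)
qed

text \<open>
Consider all assignments \<open>x\<close> of numbers up to \<open>q\<close> to the non-empty sets of even cardinality. By the
pigeonhole principle many of them share the same vector \<open>s x\<close> of sums over the sets containing a given
index. Fix one of these, \<open>z\<close>. The shifted difference \<open>q + x - z\<close> has non-negative entries, and its sums
are those of the constant assignment \<open>q\<close>: the same at every index, by symmetry. So each such \<open>x\<close>
yields a tuple with zero odd entries, and no system of equations has to be solved in non-negative integers.
\<close>
lemma c_lower_bound:
  assumes k: "k \<ge> 1"
  shows "(q + 1) ^ (2 ^ (2 * k - 1) - 1) \<le> c (2 ^ (2 * k - 2) * q) k * (2 ^ (2 * k) * (q + 1)) ^ (2 * k)"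
proof -
  let ?J = "{1..2 * k}"
  let ?P = "Pow ?J - {{}}"
  let ?m = "2 ^ (2 * k - 2) * q"
  define E where "E = {I. I \<subseteq> ?J \<and> even (card I)} - {{}}"
  have finE: "finite E"
    by (simp add: E_def)
  have cardE: "card E = 2 ^ (2 * k - 1) - 1"
    using k card_even_subsets[of ?J] by (simp add: E_def)
  have cardE_le: "card E \<le> 2 ^ (2 * k)"
  proof -
    have "card E \<le> card (Pow ?J)"
      by (intro card_mono) (auto simp: E_def)
    then show ?thesis
      by (simp add: card_Pow)
  qed
  define s where "s = (\<lambda>x :: nat set \<Rightarrow> nat. \<lambda>i\<in>?J. \<Sum>I | I \<in> E \<and> i \<in> I. x I)"
  let ?X = "E \<rightarrow>\<^sub>E {..q}"
  let ?Y = "?J \<rightarrow>\<^sub>E {..2 ^ (2 * k) * q}"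
  have finX: "finite ?X" and finY: "finite ?Y"
    using finE by (auto intro: finite_PiE)
  have "s \<in> ?X \<rightarrow> ?Y"
  proof
    fix x assume x: "x \<in> ?X"
    have "(\<Sum>I | I \<in> E \<and> i \<in> I. x I) \<le> 2 ^ (2 * k) * q" for i
    proof -
      have "(\<Sum>I | I \<in> E \<and> i \<in> I. x I) \<le> (\<Sum>I\<in>E. x I)"
        using finE by (intro sum_mono2) auto
      also have "\<dots> \<le> card E * q"
        using x sum_bounded_above[of E x q] by (auto simp: PiE_iff)
      also have "\<dots> \<le> 2 ^ (2 * k) * q"
        using cardE_le by simp
      finally show ?thesis .
    qed
    then show "s x \<in> ?Y"
      by (auto simp: s_def)
  qed
  moreover have "?Y \<noteq> {}"
    by (auto simp: PiE_eq_empty_iff)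
  ultimately obtain y where y: "card (s -` {y} \<inter> ?X) * card ?Y \<ge> card ?X"
    using pigeonhole_card[OF _ finX finY] by blast
  let ?Z = "s -` {y} \<inter> ?X"
  have cardX: "card ?X = (q + 1) ^ (2 ^ (2 * k - 1) - 1)"
    using finE cardE by (simp add: card_PiE)
  have cardY: "card ?Y \<le> (2 ^ (2 * k) * (q + 1)) ^ (2 * k)"
    by (simp add: card_PiE power_mono)
  have "card ?Z \<le> c ?m k"
  proof (cases "?Z = {}")
    case False
    then obtain z where z: "z \<in> ?X" "s z = y"
      by auto
    define g where "g = (\<lambda>x. \<lambda>I\<in>?P. if I \<in> E then q + x I - z I else 0)"
    have z_le: "z I \<le> q" if "I \<in> E" for I
      using z that by (auto simp: PiE_iff)
    have EP: "E \<subseteq> ?P"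
      by (auto simp: E_def)
    have "inj_on g ?Z"
    proof (rule inj_onI)
      fix x x' assume x: "x \<in> ?Z" "x' \<in> ?Z" "g x = g x'"
      show "x = x'"
      proof (rule extensionalityI[of _ E])
        fix I assume I: "I \<in> E"
        then have "q + x I - z I = q + x' I - z I"
          using fun_cong[OF x(3), of I] subsetD[OF EP I] by (simp add: g_def)
        then show "x I = x' I"
          using z_le[OF I] by linarith
      qed (use x in \<open>auto simp: PiE_iff\<close>)
    qed
    moreover have "g ` ?Z \<subseteq> tuples ?m k"
    proof (rule image_subsetI)
      fix x assume x: "x \<in> ?Z"
      have "(\<Sum>I | I \<subseteq> ?J \<and> i \<in> I. g x I) = ?m" if i: "i \<in> ?J" for i
      proof -
        have "s x i = s z i"
          using x z by simp
        then have eq: "(\<Sum>I | I \<in> E \<and> i \<in> I. x I) = (\<Sum>I | I \<in> E \<and> i \<in> I. z I)"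
          using i by (simp add: s_def)
        have "(\<Sum>I | I \<subseteq> ?J \<and> i \<in> I. g x I) = (\<Sum>I | I \<in> E \<and> i \<in> I. g x I)"
          using EP by (intro sum.mono_neutral_right) (auto simp: g_def)
        also have "\<dots> = (\<Sum>I | I \<in> E \<and> i \<in> I. q + x I - z I)"
          using EP by (intro sum.cong) (auto simp: g_def)
        also have "\<dots> = (\<Sum>I | I \<in> E \<and> i \<in> I. q + x I) - (\<Sum>I | I \<in> E \<and> i \<in> I. z I)"
          using z_le by (intro sum_subtractf_nat) (auto intro: trans_le_add1)
        also have "\<dots> = card {I. I \<in> E \<and> i \<in> I} * q"
          by (simp add: sum.distrib eq)
        also have "{I. I \<in> E \<and> i \<in> I} = {I. I \<subseteq> ?J \<and> i \<in> I \<and> even (card I)}"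
          by (auto simp: E_def)
        also have "card \<dots> = 2 ^ (2 * k - 2)"
        proof -
          have "card ?J \<noteq> card {i}"
            using k by simp
          then have "?J \<noteq> {i}"
            by metis
          then show ?thesis
            using card_even_subsets_containing[of ?J i] i by simp
        qed
        finally show ?thesis .
      qed
      then show "g x \<in> tuples ?m k"
        by (intro tuplesI) (auto simp: g_def E_def)
    qed
    ultimately show ?thesis
      unfolding c_def using finite_tuples by (rule card_inj_on_le)
  qed simp
  then have "card ?Z * card ?Y \<le> c ?m k * (2 ^ (2 * k) * (q + 1)) ^ (2 * k)"
    using cardY by (intro mult_le_mono)
  then show ?thesis
    using y cardX by simp
qed

section \<open>Order of growth\<close>

lemma Suc_double_le_two_power:
  assumes "k \<ge> 2"
  shows "2 * k + 1 \<le> (2::nat) ^ (2 * k - 1)"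
  using assms
proof (induction k rule: dec_induct)
  case base
  then show ?case
    by simp
next
  case (step k)
  have "2 * Suc k - 1 = Suc (Suc (2 * k - 1))"
    using step.hyps by simp
  then have "(2::nat) ^ (2 * Suc k - 1) = 2 ^ Suc (Suc (2 * k - 1))"
    by (rule arg_cong)
  also have "\<dots> = 4 * 2 ^ (2 * k - 1)"
    by simp
  finally have eq: "(2::nat) ^ (2 * Suc k - 1) = 4 * 2 ^ (2 * k - 1)" .
  have "2 * Suc k + 1 \<le> 4 * (2::nat) ^ (2 * k - 1)"
    using step.IH by simp
  then show ?case
    by (simp only: eq)
qed

text \<open>
The exponent is the number of non-empty sets of even cardinality minus the number of linear
conditions. The lower bound is available at multiples of \<open>D\<close> only, and extends to every \<open>m\<close> by
monotonicity at the cost of a constant. Since \<open>c m k \<ge> 1\<close>, adding 1 to the power of \<open>m\<close> costs a factor 2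
in the lower bound.
\<close>
lemma c_growth:
  assumes k: "k \<ge> 2"
  defines "e \<equiv> 2 ^ (2 * k - 1) - 1 - 2 * k"
  shows "\<exists>C1 C2 :: real. C1 > 0 \<and> C2 > 0 \<and> (\<forall>m\<ge>1.
    C1 * (real m ^ e + 1) \<le> real (c m k) \<and> real (c m k) \<le> C2 * (real m ^ e + 1))"
proof -
  define D :: nat where "D = 2 ^ (2 * k - 2)"
  define K :: nat where "K = D ^ e * (2 ^ (2 * k)) ^ (2 * k)"
  define L :: nat where "L = 2 ^ 2 ^ (2 * k) * 2 ^ e"
  have pos: "D > 0" "K > 0" "L > 0"
    by (simp_all add: D_def K_def L_def)
  have lower: "m ^ e \<le> K * c m k" for m
  proof -
    let ?q = "m div D"
    have "(?q + 1) ^ e * (?q + 1) ^ (2 * k) = (?q + 1) ^ (2 ^ (2 * k - 1) - 1)"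
      using Suc_double_le_two_power[OF k] by (simp add: e_def flip: power_add)
    also have "\<dots> \<le> c (D * ?q) k * (2 ^ (2 * k) * (?q + 1)) ^ (2 * k)"
      unfolding D_def using k by (intro c_lower_bound) simp
    also have "\<dots> = c (D * ?q) k * (2 ^ (2 * k)) ^ (2 * k) * (?q + 1) ^ (2 * k)"
      by (simp only: power_mult_distrib mult.assoc)
    finally have "(?q + 1) ^ e \<le> c (D * ?q) k * (2 ^ (2 * k)) ^ (2 * k)"
      by simp
    also have "\<dots> \<le> c m k * (2 ^ (2 * k)) ^ (2 * k)"
      using k by (intro mult_le_mono1 c_mono) simp_all
    finally have q: "(?q + 1) ^ e \<le> c m k * (2 ^ (2 * k)) ^ (2 * k)" .
    have "m \<le> D * (?q + 1)"
      using dividend_less_times_div[OF pos(1), of m] by simp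
    then have "m ^ e \<le> D ^ e * (?q + 1) ^ e"
      by (metis power_mono power_mult_distrib zero_le)
    also have "\<dots> \<le> D ^ e * (c m k * (2 ^ (2 * k)) ^ (2 * k))"
      using q by (rule mult_le_mono2)
    finally show ?thesis
      by (simp add: K_def mult_ac)
  qed
  have upper: "c m k \<le> L * m ^ e" if "m \<ge> 1" for m
  proof -
    have "c m k \<le> 2 ^ 2 ^ (2 * k) * (m + 1) ^ e"
      unfolding e_def by (rule c_upper_bound[OF k])
    also have "\<dots> \<le> 2 ^ 2 ^ (2 * k) * (2 * m) ^ e"
      using that by (intro mult_le_mono2 power_mono) simp_all
    finally show ?thesis
      by (simp add: L_def power_mult_distrib mult_ac)
  qed
  show ?thesis
  proof (intro exI conjI allI impI)
    show "1 / (2 * real K) > 0" "real L > 0"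
      using pos by simp_all
    fix m :: nat assume m: "m \<ge> 1"
    have "1 * 1 \<le> K * c m k"
      using pos c_ge_1[of k m] k by (intro mult_le_mono) simp_all
    then have "m ^ e + 1 \<le> 2 * (K * c m k)"
      using lower[of m] by linarith
    then have "real (m ^ e + 1) \<le> real (2 * (K * c m k))"
      by (rule of_nat_mono)
    then show "1 / (2 * real K) * (real m ^ e + 1) \<le> real (c m k)"
      using pos by (simp add: field_simps)
    have "c m k \<le> L * (m ^ e + 1)"
      using upper[OF m] by simp
    then have "real (c m k) \<le> real (L * (m ^ e + 1))"
      by (rule of_nat_mono)
    then show "real (c m k) \<le> real L * (real m ^ e + 1)"
      by (simp add: distrib_left)
  qed
qed

theorem theorem1p1:
  fixes k :: nat
  assumes "k \<ge> 1"
  shows "(\<forall>m N :: nat. m \<ge> 1 \<longrightarrow> N \<ge> 2 * m * k \<longrightarrow> Perm_moment N m k = real (c m k)) \<and>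
    mono_on {1..} (\<lambda>m. c m k) \<and>
    (\<exists>C1 C2 :: real. C1 > 0 \<and> C2 > 0 \<and>
      (\<forall>m :: nat. m \<ge> 1 \<longrightarrow>
        C1 * (real m powi (2 ^ (2 * k - 1) - 2 * int k - 1) + 1) \<le> real (c m k) \<and>
        real (c m k) \<le> C2 * (real m powi (2 ^ (2 * k - 1) - 2 * int k - 1) + 1)))"
proof (intro conjI)
  show "\<forall>m N :: nat. m \<ge> 1 \<longrightarrow> N \<ge> 2 * m * k \<longrightarrow> Perm_moment N m k = real (c m k)"
    using Perm_moment_eq_c by blast
  show "mono_on {1..} (\<lambda>m. c m k)"
    using c_mono[OF assms] by (auto simp: mono_on_def)
  show "\<exists>C1 C2 :: real. C1 > 0 \<and> C2 > 0 \<and>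
      (\<forall>m :: nat. m \<ge> 1 \<longrightarrow>
        C1 * (real m powi (2 ^ (2 * k - 1) - 2 * int k - 1) + 1) \<le> real (c m k) \<and>
        real (c m k) \<le> C2 * (real m powi (2 ^ (2 * k - 1) - 2 * int k - 1) + 1))"
  proof (cases "k \<ge> 2")
    case True
    let ?e = "2 ^ (2 * k - 1) - 1 - 2 * k :: nat"
    have "int ?e = 2 ^ (2 * k - 1) - 2 * int k - 1"
      using Suc_double_le_two_power[OF True] by (simp add: of_nat_diff)
    then have powi_eq: "real m powi (2 ^ (2 * k - 1) - 2 * int k - 1) = real m ^ ?e" for m
      by (metis power_int_of_nat)
    show ?thesis
      unfolding powi_eq using c_growth[OF True] .
  next
    case False
    then have k: "k = 1"
      using assms by simp
    show ?thesis
    proof (intro exI conjI allI impI)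
      show "(1 / 2 :: real) > 0" "(4 :: real) > 0"
        by simp_all
      fix m :: nat assume m: "m \<ge> 1"
      \<comment> \<open>The exponent is \<open>- 1\<close>, so the comparison function lies between 1 and 2, while \<open>c m 1\<close> lies between 1
        and 4.\<close>
      define x where "x = real m powi (2 ^ (2 * k - 1) - 2 * int k - 1)"
      have "x = 1 / real m"
        by (simp add: x_def k power_int_minus_divide)
      then have x: "0 \<le> x" "x \<le> 1"
        using m by simp_all
      have c: "1 \<le> real (c m k)" "real (c m k) \<le> 4"
        using c_ge_1[OF assms, of m] c_1_le[of m] by (simp_all add: k)
      have "1 / 2 * (x + 1) \<le> 1" "4 \<le> 4 * (x + 1)"
        using x by simp_all
      with c show "1 / 2 * (real m powi (2 ^ (2 * k - 1) - 2 * int k - 1) + 1) \<le> real (c m k)"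
        and "real (c m k) \<le> 4 * (real m powi (2 ^ (2 * k - 1) - 2 * int k - 1) + 1)"
        unfolding x_def by (blast intro: order_trans)+
    qed
  qed
qed

end
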